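(* Let $F$ be an algebraically closed field, $R$ an $F$-algebra, $\sigma$ an $F$-algebra automorphism and $\delta$ a $\sigma$-derivation of $R$, and $T=R[x;\sigma,\delta]$. Assume that $T$ is a Hopf $F$-algebra and that $R$ is a right or left coideal subalgebra of $T$. Then either every $M\in\Xi(T)$ is of invariant type, or every $M\in\Xi(T)$ is of variant type.
   Context: Hopf algebras have bijective antipode. $R[x;\sigma,\delta]$ is the skew polynomial algebra with $xr-\sigma(r)x=\delta(r)$, $\delta(ab)=\delta(a)b+\sigma(a)\delta(b)$. $\Xi(T)$ is the set of ideals $M$ of $T$ with $T/M\cong F$. For $M\in\Xi(T)$ put $\mathfrak m=M\cap R$. $M$ is of invariant type if $\sigma(\mathfrak m)=\mathfrak m$ and $\delta(\mathfrak m)\subseteq\mathfrak m$; $M$ is of variant type if $\sigma(\mathfrak m)\neq\mathfrak m$ and $\delta([R,R])\subseteq\mathfrak m$, where $[R,R]$ is the set of commutators. *)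

theory Defs
  imports "HOL-Computational_Algebra.Polynomial"
begin

text \<open>Ambient setting: the ring T is the whole type 'b :: ring_1, the ground field F
is the type 'k :: alg_closed_field, and sm :: 'k => 'b => 'b is the scalar
multiplication making T an F-algebra.\<close>

definition F_algebra :: "('k::field \<Rightarrow> 'b::ring_1 \<Rightarrow> 'b) \<Rightarrow> bool" where
  "F_algebra sm \<longleftrightarrow> vector_space sm \<and>
     (\<forall>c a b. sm c (a * b) = sm c a * b \<and> sm c (a * b) = a * sm c b)"

abbreviation lin_fun :: "('k::field \<Rightarrow> 'b::ab_group_add \<Rightarrow> 'b) \<Rightarrow> ('b \<Rightarrow> 'k) \<Rightarrow> bool" where
  "lin_fun sm f \<equiv> Vector_Spaces.linear sm (*) f"

text \<open>Elements of T (x) T are represented by finite lists [(a1,b1),...] standing for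
sum a_i (x) b_i; elements of T (x) T (x) T likewise by lists of triples.
Two representatives denote the same tensor iff all products of linear functionals agree
on them (linear functionals separate points of tensor products of vector spaces).\<close>

definition ev2 :: "('b \<Rightarrow> 'k::field) \<Rightarrow> ('b \<Rightarrow> 'k) \<Rightarrow> ('b \<times> 'b) list \<Rightarrow> 'k" where
  "ev2 f g xs = (\<Sum>(a, b)\<leftarrow>xs. f a * g b)"

definition ev3 :: "('b \<Rightarrow> 'k::field) \<Rightarrow> ('b \<Rightarrow> 'k) \<Rightarrow> ('b \<Rightarrow> 'k) \<Rightarrow> ('b \<times> 'b \<times> 'b) list \<Rightarrow> 'k" where
  "ev3 f g h xs = (\<Sum>(a, b, c)\<leftarrow>xs. f a * g b * h c)"

definition teq2 :: "('k::field \<Rightarrow> 'b::ab_group_add \<Rightarrow> 'b) \<Rightarrow> ('b \<times> 'b) list \<Rightarrow> ('b \<times> 'b) list \<Rightarrow> bool" where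
  "teq2 sm xs ys \<longleftrightarrow> (\<forall>f g. lin_fun sm f \<and> lin_fun sm g \<longrightarrow> ev2 f g xs = ev2 f g ys)"

definition teq3 :: "('k::field \<Rightarrow> 'b::ab_group_add \<Rightarrow> 'b) \<Rightarrow> ('b \<times> 'b \<times> 'b) list \<Rightarrow> ('b \<times> 'b \<times> 'b) list \<Rightarrow> bool" where
  "teq3 sm xs ys \<longleftrightarrow> (\<forall>f g h. lin_fun sm f \<and> lin_fun sm g \<and> lin_fun sm h \<longrightarrow> ev3 f g h xs = ev3 f g h ys)"

definition tmul :: "('b::ring_1 \<times> 'b) list \<Rightarrow> ('b \<times> 'b) list \<Rightarrow> ('b \<times> 'b) list" where
  "tmul xs ys = concat (map (\<lambda>(a, b). map (\<lambda>(c, d). (a * c, b * d)) ys) xs)"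

definition hopf_algebra ::
  "('k::field \<Rightarrow> 'b::ring_1 \<Rightarrow> 'b) \<Rightarrow> ('b \<Rightarrow> ('b \<times> 'b) list) \<Rightarrow> ('b \<Rightarrow> 'k) \<Rightarrow> ('b \<Rightarrow> 'b) \<Rightarrow> bool" where
  "hopf_algebra sm \<Delta> \<epsilon> S \<longleftrightarrow>
     F_algebra sm \<and>
     \<comment> \<open>Delta is F-linear\<close>
     (\<forall>f g. lin_fun sm f \<and> lin_fun sm g \<longrightarrow> lin_fun sm (\<lambda>t. ev2 f g (\<Delta> t))) \<and>
     \<comment> \<open>Delta is an algebra map\<close>
     teq2 sm (\<Delta> 1) [(1, 1)] \<and>
     (\<forall>a b. teq2 sm (\<Delta> (a * b)) (tmul (\<Delta> a) (\<Delta> b))) \<and>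
     \<comment> \<open>coassociativity\<close>
     (\<forall>t. teq3 sm (concat (map (\<lambda>(a, b). map (\<lambda>(c, d). (c, d, b)) (\<Delta> a)) (\<Delta> t)))
                  (concat (map (\<lambda>(a, b). map (\<lambda>(c, d). (a, c, d)) (\<Delta> b)) (\<Delta> t)))) \<and>
     \<comment> \<open>counit: algebra map with counit axioms\<close>
     lin_fun sm \<epsilon> \<and> \<epsilon> 1 = 1 \<and> (\<forall>a b. \<epsilon> (a * b) = \<epsilon> a * \<epsilon> b) \<and>
     (\<forall>t. (\<Sum>(a, b)\<leftarrow>\<Delta> t. sm (\<epsilon> a) b) = t \<and> (\<Sum>(a, b)\<leftarrow>\<Delta> t. sm (\<epsilon> b) a) = t) \<and>
     \<comment> \<open>antipode\<close>
     Vector_Spaces.linear sm sm S \<and>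
     (\<forall>t. (\<Sum>(a, b)\<leftarrow>\<Delta> t. S a * b) = sm (\<epsilon> t) 1 \<and> (\<Sum>(a, b)\<leftarrow>\<Delta> t. a * S b) = sm (\<epsilon> t) 1) \<and>
     bij S"

definition subalgebra :: "('k::field \<Rightarrow> 'b::ring_1 \<Rightarrow> 'b) \<Rightarrow> 'b set \<Rightarrow> bool" where
  "subalgebra sm R \<longleftrightarrow> 1 \<in> R \<and> (\<forall>a\<in>R. \<forall>b\<in>R. a + b \<in> R \<and> a * b \<in> R) \<and>
     (\<forall>c. \<forall>a\<in>R. sm c a \<in> R)"

definition right_coideal :: "('k::field \<Rightarrow> 'b::ring_1 \<Rightarrow> 'b) \<Rightarrow> ('b \<Rightarrow> ('b \<times> 'b) list) \<Rightarrow> 'b set \<Rightarrow> bool" where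
  "right_coideal sm \<Delta> R \<longleftrightarrow> (\<forall>r\<in>R. \<exists>ys. fst ` set ys \<subseteq> R \<and> teq2 sm (\<Delta> r) ys)"

definition left_coideal :: "('k::field \<Rightarrow> 'b::ring_1 \<Rightarrow> 'b) \<Rightarrow> ('b \<Rightarrow> ('b \<times> 'b) list) \<Rightarrow> 'b set \<Rightarrow> bool" where
  "left_coideal sm \<Delta> R \<longleftrightarrow> (\<forall>r\<in>R. \<exists>ys. snd ` set ys \<subseteq> R \<and> teq2 sm (\<Delta> r) ys)"

definition F_alg_automorphism :: "('k::field \<Rightarrow> 'b::ring_1 \<Rightarrow> 'b) \<Rightarrow> 'b set \<Rightarrow> ('b \<Rightarrow> 'b) \<Rightarrow> bool" where
  "F_alg_automorphism sm R \<sigma> \<longleftrightarrow> bij_betw \<sigma> R R \<and> \<sigma> 1 = 1 \<and>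
     (\<forall>a\<in>R. \<forall>b\<in>R. \<sigma> (a + b) = \<sigma> a + \<sigma> b \<and> \<sigma> (a * b) = \<sigma> a * \<sigma> b) \<and>
     (\<forall>c. \<forall>a\<in>R. \<sigma> (sm c a) = sm c (\<sigma> a))"

definition sigma_derivation :: "('k::field \<Rightarrow> 'b::ring_1 \<Rightarrow> 'b) \<Rightarrow> 'b set \<Rightarrow> ('b \<Rightarrow> 'b) \<Rightarrow> ('b \<Rightarrow> 'b) \<Rightarrow> bool" where
  "sigma_derivation sm R \<sigma> \<delta> \<longleftrightarrow> \<delta> ` R \<subseteq> R \<and>
     (\<forall>a\<in>R. \<forall>b\<in>R. \<delta> (a + b) = \<delta> a + \<delta> b \<and> \<delta> (a * b) = \<delta> a * b + \<sigma> a * \<delta> b) \<and>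
     (\<forall>c. \<forall>a\<in>R. \<delta> (sm c a) = sm c (\<delta> a))"

definition is_skew_poly_alg ::
  "('k::field \<Rightarrow> 'b::ring_1 \<Rightarrow> 'b) \<Rightarrow> 'b set \<Rightarrow> ('b \<Rightarrow> 'b) \<Rightarrow> ('b \<Rightarrow> 'b) \<Rightarrow> 'b \<Rightarrow> bool" where
  "is_skew_poly_alg sm R \<sigma> \<delta> x \<longleftrightarrow> subalgebra sm R \<and>
     (\<forall>r\<in>R. x * r - \<sigma> r * x = \<delta> r) \<and>
     (\<forall>t. \<exists>!c :: nat \<Rightarrow> 'b. (\<forall>i. c i \<in> R) \<and> finite {i. c i \<noteq> 0} \<and>
            t = (\<Sum>i\<in>{i. c i \<noteq> 0}. c i * x ^ i))"

definition two_sided_ideal :: "'b::ring_1 set \<Rightarrow> bool" where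
  "two_sided_ideal M \<longleftrightarrow> 0 \<in> M \<and> (\<forall>a\<in>M. \<forall>b\<in>M. a + b \<in> M) \<and>
     (\<forall>a\<in>M. \<forall>t. t * a \<in> M \<and> a * t \<in> M)"

text \<open>Xi(T): ideals M with T/M isomorphic to F as F-algebras, i.e. kernels of
(necessarily surjective) F-algebra maps T -> F.\<close>
definition Xi :: "('k::field \<Rightarrow> 'b::ring_1 \<Rightarrow> 'b) \<Rightarrow> 'b set set" where
  "Xi sm = {M. two_sided_ideal M \<and>
     (\<exists>\<chi>. lin_fun sm \<chi> \<and> \<chi> 1 = 1 \<and> (\<forall>a b. \<chi> (a * b) = \<chi> a * \<chi> b) \<and>
          M = {t. \<chi> t = 0})}"

definition invariant_type :: "'b set \<Rightarrow> ('b \<Rightarrow> 'b) \<Rightarrow> ('b \<Rightarrow> 'b) \<Rightarrow> 'b set \<Rightarrow> bool" where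
  "invariant_type R \<sigma> \<delta> M \<longleftrightarrow> \<sigma> ` (M \<inter> R) = M \<inter> R \<and> \<delta> ` (M \<inter> R) \<subseteq> M \<inter> R"

definition variant_type :: "'b::ring_1 set \<Rightarrow> ('b \<Rightarrow> 'b) \<Rightarrow> ('b \<Rightarrow> 'b) \<Rightarrow> 'b set \<Rightarrow> bool" where
  "variant_type R \<sigma> \<delta> M \<longleftrightarrow> \<sigma> ` (M \<inter> R) \<noteq> M \<inter> R \<and>
     \<delta> ` {a * b - b * a | a b. a \<in> R \<and> b \<in> R} \<subseteq> M \<inter> R"

end

theory Submission
  imports Defs
begin

text \<open>A character \<open>\<chi>\<close> of \<open>T\<close> satisfies \<open>\<chi>(\<delta> r) = \<chi>(x) (\<chi>(r) - \<chi>(\<sigma> r))\<close>. Hence \<open>ker \<chi>\<close> is of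
invariant type if \<open>\<sigma>\<close> fixes the restriction of \<open>\<chi>\<close> to \<open>R\<close>, and of variant type otherwise. Moreover
\<open>\<sigma>\<close> fixes this restriction iff \<open>\<chi>\<close> is not the only character of \<open>T\<close> extending it: then the value
at \<open>x\<close> can be chosen freely, while otherwise it is forced by the identity above. The characters form
a group under convolution, and as \<open>R\<close> is a right (left) coideal, right (left) translations of this
group respect equality of restrictions to \<open>R\<close>. So the extension is nonunique for all
characters or for none.\<close>

section \<open>Characters, linear functionals and tensors in list form\<close>

definition is_character :: "('k::field \<Rightarrow> 'b::ring_1 \<Rightarrow> 'b) \<Rightarrow> ('b \<Rightarrow> 'k) \<Rightarrow> bool" where
  "is_character sm \<chi> \<longleftrightarrow> lin_fun sm \<chi> \<and> \<chi> 1 = 1 \<and> (\<forall>a b. \<chi> (a * b) = \<chi> a * \<chi> b)"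

lemma lin_fun_iff:
  assumes "vector_space sm"
  shows "lin_fun sm f \<longleftrightarrow> (\<forall>a b. f (a + b) = f a + f b) \<and> (\<forall>c a. f (sm c a) = c * f a)"
proof -
  have "vector_space ((*) :: 'a \<Rightarrow> 'a \<Rightarrow> 'a)"
    by unfold_locales (auto simp: algebra_simps)
  with assms show ?thesis
    by (simp add: Vector_Spaces.linear_iff)
qed

lemma lin_fun_zero: "vector_space sm \<Longrightarrow> lin_fun sm f \<Longrightarrow> f 0 = 0"
  by (metis add_cancel_right_right lin_fun_iff)

lemma lin_fun_diff: "vector_space sm \<Longrightarrow> lin_fun sm f \<Longrightarrow> f (a - b) = f a - f b"
  by (metis add_diff_cancel_right' diff_add_cancel lin_fun_iff)

lemma lin_fun_sum_list:
  "vector_space sm \<Longrightarrow> lin_fun sm f \<Longrightarrow> f (sum_list xs) = sum_list (map f xs)"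
  by (induction xs) (auto simp: lin_fun_iff lin_fun_zero)

text \<open>A nonzero vector \<open>a - b\<close> forms an independent set, so some functional takes
  the value 1 on it. This allows identities in T to be proved by applying functionals.\<close>

lemma lin_fun_separates:
  assumes "vector_space sm" and "\<And>f. lin_fun sm f \<Longrightarrow> f a = f b"
  shows "a = b"
proof (rule ccontr)
  assume "a \<noteq> b"
  interpret V: vector_space sm by fact
  interpret P: vector_space_pair sm "(*) :: 'a \<Rightarrow> 'a \<Rightarrow> 'a"
    by unfold_locales (auto simp: algebra_simps)
  have "V.independent {a - b}"
    using \<open>a \<noteq> b\<close> by simp
  then obtain f where f: "lin_fun sm f" "f (a - b) = 1"
    using P.linear_independent_extend[of "{a - b}" "\<lambda>_. 1"] by auto
  with assms(2)[OF f(1)] show False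
    by (simp add: lin_fun_diff[OF assms(1) f(1)])
qed

lemma ev2_eq: "teq2 sm xs ys \<Longrightarrow> lin_fun sm f \<Longrightarrow> lin_fun sm g \<Longrightarrow> ev2 f g xs = ev2 f g ys"
  by (simp add: teq2_def)

lemma ev2_append: "ev2 f g (xs @ ys) = ev2 f g xs + ev2 f g ys"
  by (simp add: ev2_def)

lemma ev3_append: "ev3 f g h (xs @ ys) = ev3 f g h xs + ev3 f g h ys"
  by (simp add: ev3_def)

text \<open>The values lie in a commutative field, so the factors \<open>f\<close>, \<open>g\<close>
  of each product term can be regrouped. This is what makes the convolution of two characters
  multiplicative.\<close>

lemma ev2_tmul:
  assumes "\<And>a b. f (a * b) = f a * f b" and "\<And>a b. g (a * b) = g a * g b"
  shows "ev2 f g (tmul xs ys) = ev2 f g xs * ev2 f g ys"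
proof -
  have "ev2 f g (map (\<lambda>(c, d). (a * c, b * d)) ys) = f a * g b * ev2 f g ys" for a b
    using assms by (induction ys) (auto simp: ev2_def algebra_simps)
  then show ?thesis
    by (induction xs) (auto simp: tmul_def ev2_append, auto simp: ev2_def algebra_simps)
qed

text \<open>For \<open>D = \<Delta>\<close> the list represents the image of a tensor under
  \<open>\<Delta> \<otimes> id\<close>, and the first two functionals merge into their convolution.
  Together with the mirror image below, this turns coassociativity into associativity of
  convolution.\<close>

lemma ev3_left:
  "ev3 f g h (concat (map (\<lambda>(a, b). map (\<lambda>(c, d). (c, d, b)) (D a)) xs)) =
    ev2 (\<lambda>a. ev2 f g (D a)) h xs"
proof -
  have "ev3 f g h (map (\<lambda>(c, d). (c, d, b)) ys) = ev2 f g ys * h b" for b ys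
    by (induction ys) (auto simp: ev2_def ev3_def algebra_simps)
  then show ?thesis
    by (induction xs) (auto simp: ev3_append, auto simp: ev2_def ev3_def)
qed

lemma ev3_right:
  "ev3 f g h (concat (map (\<lambda>(a, b). map (\<lambda>(c, d). (a, c, d)) (D b)) xs)) =
    ev2 f (\<lambda>b. ev2 g h (D b)) xs"
proof -
  have "ev3 f g h (map (\<lambda>(c, d). (a, c, d)) ys) = f a * ev2 g h ys" for a ys
    by (induction ys) (auto simp: ev2_def ev3_def algebra_simps)
  then show ?thesis
    by (induction xs) (auto simp: ev3_append, auto simp: ev2_def ev3_def)
qed

section \<open>Convolution and the group of characters of a Hopf algebra\<close>

locale hopf =
  fixes sm :: "'k::field \<Rightarrow> 'b::ring_1 \<Rightarrow> 'b"
    and \<Delta> :: "'b \<Rightarrow> ('b \<times> 'b) list" and \<epsilon> :: "'b \<Rightarrow> 'k" and S :: "'b \<Rightarrow> 'b"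
  assumes hopf: "hopf_algebra sm \<Delta> \<epsilon> S"
begin

lemma vec: "vector_space sm"
  and sm_mult: "sm c (a * b) = sm c a * b" "sm c (a * b) = a * sm c b"
  using hopf unfolding hopf_algebra_def F_algebra_def by blast+

lemmas lin_iff = lin_fun_iff[OF vec]
  and lin_sum_list = lin_fun_sum_list[OF vec]

text \<open>The multiplication of the algebra dual to the coalgebra T; its identity is
  \<epsilon>.\<close>

definition conv :: "('b \<Rightarrow> 'k) \<Rightarrow> ('b \<Rightarrow> 'k) \<Rightarrow> 'b \<Rightarrow> 'k" where
  "conv f g t = ev2 f g (\<Delta> t)"

text \<open>The map \<open>(f \<otimes> id) \<circ> \<Delta>\<close>, the left winding endomorphism
  when \<open>f\<close> is a character. It is the transpose of left convolution by
  \<open>f\<close>.\<close>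

definition winding :: "('b \<Rightarrow> 'k) \<Rightarrow> 'b \<Rightarrow> 'b" where
  "winding f t = (\<Sum>(a, b)\<leftarrow>\<Delta> t. sm (f a) b)"

lemma character_counit: "is_character sm \<epsilon>"
  using hopf by (simp add: hopf_algebra_def is_character_def)

lemma lin_conv: "lin_fun sm f \<Longrightarrow> lin_fun sm g \<Longrightarrow> lin_fun sm (conv f g)"
  using hopf unfolding hopf_algebra_def conv_def[abs_def] by blast

lemma conv_assoc:
  assumes "lin_fun sm f" "lin_fun sm g" "lin_fun sm h"
  shows "conv (conv f g) h = conv f (conv g h)"
proof
  fix t
  have "teq3 sm (concat (map (\<lambda>(a, b). map (\<lambda>(c, d). (c, d, b)) (\<Delta> a)) (\<Delta> t)))
    (concat (map (\<lambda>(a, b). map (\<lambda>(c, d). (a, c, d)) (\<Delta> b)) (\<Delta> t)))"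
    using hopf by (simp add: hopf_algebra_def)
  with assms show "conv (conv f g) h t = conv f (conv g h) t"
    unfolding teq3_def ev3_left ev3_right conv_def[abs_def] by blast
qed

lemma lin_winding:
  assumes "lin_fun sm g"
  shows "g (winding f t) = conv f g t"
proof -
  have "g (\<Sum>(a, b)\<leftarrow>xs. sm (f a) b) = ev2 f g xs" for xs
    using assms lin_fun_zero[OF vec assms] by (induction xs) (auto simp: ev2_def lin_iff)
  then show ?thesis
    by (simp add: winding_def conv_def)
qed

lemma conv_counit_left: "lin_fun sm f \<Longrightarrow> conv \<epsilon> f = f"
  using hopf lin_winding[of f \<epsilon>] by (auto simp: hopf_algebra_def winding_def)

lemma conv_counit_right:
  assumes "lin_fun sm f"
  shows "conv f \<epsilon> = f"
proof
  fix t
  have "f (\<Sum>(a, b)\<leftarrow>xs. sm (\<epsilon> b) a) = ev2 f \<epsilon> xs" for xs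
    using assms lin_fun_zero[OF vec assms] by (induction xs) (auto simp: ev2_def lin_iff)
  then show "conv f \<epsilon> t = f t"
    using hopf by (metis conv_def hopf_algebra_def)
qed

lemma lin_antipode: "lin_fun sm f \<Longrightarrow> lin_fun sm (f \<circ> S)"
  using hopf by (auto simp: hopf_algebra_def lin_iff Vector_Spaces.linear_iff)

text \<open>Applying the multiplicative \<chi> to the two antipode axioms shows that
  \<open>\<chi> \<circ> S\<close> is the convolution inverse of \<chi>. Multiplicativity of S is not
  involved.\<close>

lemma conv_antipode:
  assumes "is_character sm \<chi>"
  shows "conv \<chi> (\<chi> \<circ> S) = \<epsilon>" and "conv (\<chi> \<circ> S) \<chi> = \<epsilon>"
proof -
  have lin: "lin_fun sm \<chi>" and one: "\<chi> 1 = 1" and mult: "\<And>a b. \<chi> (a * b) = \<chi> a * \<chi> b"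
    using assms by (auto simp: is_character_def)
  have unit: "\<chi> (sm c 1) = c" for c
    using lin one by (simp add: lin_iff)
  have "\<chi> (\<Sum>(a, b)\<leftarrow>xs. a * S b) = ev2 \<chi> (\<chi> \<circ> S) xs"
    and "\<chi> (\<Sum>(a, b)\<leftarrow>xs. S a * b) = ev2 (\<chi> \<circ> S) \<chi> xs" for xs
    by (auto simp: ev2_def lin_sum_list[OF lin] mult o_def case_prod_unfold)
  moreover have "(\<Sum>(a, b)\<leftarrow>\<Delta> t. S a * b) = sm (\<epsilon> t) 1"
    and "(\<Sum>(a, b)\<leftarrow>\<Delta> t. a * S b) = sm (\<epsilon> t) 1" for t
    using hopf by (simp_all add: hopf_algebra_def)
  ultimately show "conv \<chi> (\<chi> \<circ> S) = \<epsilon>" and "conv (\<chi> \<circ> S) \<chi> = \<epsilon>"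
    by (metis conv_def ext unit)+
qed

lemma ev2_comult_mult:
  assumes "lin_fun sm f" "lin_fun sm g"
  shows "ev2 f g (\<Delta> (a * b)) = ev2 f g (tmul (\<Delta> a) (\<Delta> b))"
  using hopf assms by (simp add: hopf_algebra_def teq2_def)

lemma conv_one: "lin_fun sm f \<Longrightarrow> lin_fun sm g \<Longrightarrow> conv f g 1 = f 1 * g 1"
  using hopf by (simp add: hopf_algebra_def teq2_def conv_def ev2_def)

lemma character_conv:
  assumes "is_character sm \<chi>" "is_character sm \<psi>"
  shows "is_character sm (conv \<chi> \<psi>)"
  using assms ev2_tmul[of \<chi> \<psi>]
  unfolding is_character_def by (simp add: lin_conv conv_one) (simp add: conv_def ev2_comult_mult)

text \<open>Winding by a character is multiplicative because \<Delta> and \<chi> are. The claim is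
  stated after applying a linear \<open>f\<close>, since \<Delta> respects products only up to
  \<open>teq2\<close>, which functionals detect.\<close>

lemma lin_winding_mult:
  assumes "is_character sm \<chi>" "lin_fun sm f"
  shows "f (winding \<chi> a * winding \<chi> b) = conv \<chi> f (a * b)"
proof -
  have lin: "lin_fun sm \<chi>" and mult: "\<And>a b. \<chi> (a * b) = \<chi> a * \<chi> b"
    using assms by (auto simp: is_character_def)
  have f: "f (u + v) = f u + f v" "f (sm c u) = c * f u" "f 0 = 0" for u v c
    using assms(2) lin_fun_zero[OF vec assms(2)] by (auto simp: lin_iff)
  \<comment> \<open>One term of the first factor against the whole second factor, matching the inner
    \<open>map\<close> in \<open>tmul\<close>.\<close>
  have row: "f (sm (\<chi> p) q * (\<Sum>(a, b)\<leftarrow>ys. sm (\<chi> a) b)) =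
      ev2 \<chi> f (map (\<lambda>(c, d). (p * c, q * d)) ys)" for p q ys
    by (induction ys)
      (auto simp: ev2_def f mult distrib_left simp flip: sm_mult)
  have "f ((\<Sum>(a, b)\<leftarrow>xs. sm (\<chi> a) b) * (\<Sum>(a, b)\<leftarrow>ys. sm (\<chi> a) b)) = ev2 \<chi> f (tmul xs ys)"
    for xs ys
    by (induction xs) (auto simp: tmul_def ev2_append f distrib_right row, simp add: ev2_def)
  then show ?thesis
    using ev2_comult_mult[OF lin assms(2)] by (simp add: winding_def conv_def)
qed

text \<open>Windings compose in the order opposite to convolution, so the composite is winding by
  \<open>conv (\<chi> \<circ> S) \<chi>\<close>, that is by \<epsilon>, which is the identity. Hence
  \<open>winding \<chi>\<close> is onto.\<close>

lemma winding_antipode: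
  assumes "is_character sm \<chi>"
  shows "winding \<chi> (winding (\<chi> \<circ> S) t) = t"
proof (rule lin_fun_separates[OF vec])
  fix f assume f: "lin_fun sm f"
  have lin: "lin_fun sm \<chi>"
    using assms by (simp add: is_character_def)
  have "f (winding \<chi> (winding (\<chi> \<circ> S) t)) = conv (\<chi> \<circ> S) (conv \<chi> f) t"
    using f lin by (simp add: lin_winding lin_conv)
  also have "\<dots> = conv (conv (\<chi> \<circ> S) \<chi>) f t"
    using conv_assoc[OF lin_antipode[OF lin] lin f] by simp
  finally show "f (winding \<chi> (winding (\<chi> \<circ> S) t)) = f t"
    using assms f by (simp add: conv_antipode conv_counit_left)
qed

text \<open>Winding by \<open>\<chi>\<close> is a surjective algebra map that carries \<open>\<chi> \<circ> S\<close> back to the multiplicative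
functional \<open>\<epsilon>\<close>; this replaces the proof that \<open>S\<close> is an anti-homomorphism.\<close>

lemma character_antipode:
  assumes "is_character sm \<chi>"
  shows "is_character sm (\<chi> \<circ> S)"
  unfolding is_character_def
proof (intro conjI allI)
  have lin: "lin_fun sm \<chi>" and one: "\<chi> 1 = 1"
    using assms by (auto simp: is_character_def)
  show linS: "lin_fun sm (\<chi> \<circ> S)"
    using lin by (rule lin_antipode)
  have eps: "\<epsilon> 1 = 1" "\<epsilon> (a * b) = \<epsilon> a * \<epsilon> b" for a b
    using character_counit by (auto simp: is_character_def)
  show "(\<chi> \<circ> S) 1 = 1"
    using conv_one[OF lin linS] eps one conv_antipode(1)[OF assms] by simp
  fix a b
  define a' b' where "a' = winding (\<chi> \<circ> S) a" and "b' = winding (\<chi> \<circ> S) b"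
  have ab: "a = winding \<chi> a'" "b = winding \<chi> b'"
    using winding_antipode[OF assms] by (simp_all add: a'_def b'_def)
  have S: "(\<chi> \<circ> S) (winding \<chi> t) = \<epsilon> t" for t
    using lin_winding[OF linS] conv_antipode(1)[OF assms] by simp
  show "(\<chi> \<circ> S) (a * b) = (\<chi> \<circ> S) a * (\<chi> \<circ> S) b"
    unfolding ab S using lin_winding_mult[OF assms linS] conv_antipode(1)[OF assms] eps
    by simp
qed

section \<open>Translation of characters and restriction to a coideal subalgebra\<close>

lemma conv_cong_right_coideal:
  assumes "right_coideal sm \<Delta> R" "r \<in> R" "lin_fun sm f" "lin_fun sm f'" "lin_fun sm g"
    and "\<And>r. r \<in> R \<Longrightarrow> f r = f' r"
  shows "conv f g r = conv f' g r"
proof -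
  obtain ys where ys: "fst ` set ys \<subseteq> R" "teq2 sm (\<Delta> r) ys"
    using assms(1,2) by (auto simp: right_coideal_def)
  \<comment> \<open>The list \<open>\<Delta> r\<close> itself may have first legs outside R; the
    equivalent list \<open>ys\<close> has them in R, where \<open>f\<close> and \<open>f'\<close>
    agree.\<close>
  have "ev2 f g ys = ev2 f' g ys"
    unfolding ev2_def using ys(1) assms(6)
    by (intro arg_cong[where f = sum_list] map_cong) auto
  then show ?thesis
    using ev2_eq[OF ys(2)] assms(3-5) by (simp add: conv_def)
qed

lemma conv_cong_left_coideal:
  assumes "left_coideal sm \<Delta> R" "r \<in> R" "lin_fun sm f" "lin_fun sm f'" "lin_fun sm g"
    and "\<And>r. r \<in> R \<Longrightarrow> f r = f' r"
  shows "conv g f r = conv g f' r"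
proof -
  obtain ys where ys: "snd ` set ys \<subseteq> R" "teq2 sm (\<Delta> r) ys"
    using assms(1,2) by (auto simp: left_coideal_def)
  have "ev2 g f ys = ev2 g f' ys"
    unfolding ev2_def using ys(1) assms(6)
    by (intro arg_cong[where f = sum_list] map_cong) auto
  then show ?thesis
    using ev2_eq[OF ys(2)] assms(3-5) by (simp add: conv_def)
qed

lemma conv_right_cancel:
  assumes "is_character sm \<psi>" "lin_fun sm f" "lin_fun sm g" "conv f \<psi> = conv g \<psi>"
  shows "f = g"
proof -
  have "lin_fun sm \<psi>"
    using assms(1) by (simp add: is_character_def)
  then have "conv (conv h \<psi>) (\<psi> \<circ> S) = h" if "lin_fun sm h" for h
    using that conv_assoc lin_antipode conv_antipode(1)[OF assms(1)] conv_counit_right by metis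
  with assms(2-4) show ?thesis by metis
qed

lemma conv_left_cancel:
  assumes "is_character sm \<psi>" "lin_fun sm f" "lin_fun sm g" "conv \<psi> f = conv \<psi> g"
  shows "f = g"
proof -
  have "lin_fun sm \<psi>"
    using assms(1) by (simp add: is_character_def)
  then have "conv (\<psi> \<circ> S) (conv \<psi> h) = h" if "lin_fun sm h" for h
    using that conv_assoc lin_antipode conv_antipode(2)[OF assms(1)] conv_counit_left by metis
  with assms(2-4) show ?thesis by metis
qed

text \<open>A translation of the character group that takes \<chi> to \<psi> takes \<chi>' to the
  desired \<open>\<psi>'\<close>: it is injective, and on the side matching the coideal it preserves
  equality of restrictions to R.\<close>

lemma nonunique_extension_transfer:
  assumes coideal: "right_coideal sm \<Delta> R \<or> left_coideal sm \<Delta> R"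
    and \<chi>: "is_character sm \<chi>" and \<chi>': "is_character sm \<chi>'" and neq: "\<chi> \<noteq> \<chi>'"
    and eq: "\<And>r. r \<in> R \<Longrightarrow> \<chi> r = \<chi>' r"
    and \<psi>: "is_character sm \<psi>"
  shows "\<exists>\<psi>'. is_character sm \<psi>' \<and> \<psi>' \<noteq> \<psi> \<and> (\<forall>r\<in>R. \<psi> r = \<psi>' r)"
proof -
  define \<eta> where "\<eta> = \<chi> \<circ> S"
  have \<eta>: "is_character sm \<eta>" "conv \<chi> \<eta> = \<epsilon>" "conv \<eta> \<chi> = \<epsilon>"
    using character_antipode[OF \<chi>] conv_antipode[OF \<chi>] by (simp_all add: \<eta>_def)
  have lin: "lin_fun sm \<chi>" "lin_fun sm \<chi>'" "lin_fun sm \<psi>" "lin_fun sm \<eta>"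
    using \<chi> \<chi>' \<psi> \<eta> by (auto simp: is_character_def)
  from coideal show ?thesis
  proof
    assume R: "right_coideal sm \<Delta> R"
    \<comment> \<open>The solution of \<open>conv \<chi> \<omega> = \<psi>\<close>. In a right
      coideal the first legs stay in R, so \<chi> and \<chi>' must be the left factors.\<close>
    define \<omega> where "\<omega> = conv \<eta> \<psi>"
    have \<omega>: "is_character sm \<omega>" "lin_fun sm \<omega>" "conv \<chi> \<omega> = \<psi>"
      using \<eta> \<psi> lin conv_assoc[of \<chi> \<eta> \<psi>]
      by (simp_all add: \<omega>_def character_conv lin_conv conv_counit_left)
    have "conv \<chi>' \<omega> \<noteq> \<psi>"
      using conv_right_cancel[OF \<omega>(1) lin(1,2)] neq \<omega>(3) by auto
    moreover have "\<psi> r = conv \<chi>' \<omega> r" if "r \<in> R" for r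
      using conv_cong_right_coideal[OF R that lin(1,2) \<omega>(2) eq] \<omega>(3) by simp
    ultimately show ?thesis
      using character_conv[OF \<chi>' \<omega>(1)] by blast
  next
    assume R: "left_coideal sm \<Delta> R"
    define \<omega> where "\<omega> = conv \<psi> \<eta>"
    have \<omega>: "is_character sm \<omega>" "lin_fun sm \<omega>" "conv \<omega> \<chi> = \<psi>"
      using \<eta> \<psi> lin conv_assoc[of \<psi> \<eta> \<chi>]
      by (simp_all add: \<omega>_def character_conv lin_conv conv_counit_right)
    have "conv \<omega> \<chi>' \<noteq> \<psi>"
      using conv_left_cancel[OF \<omega>(1) lin(1,2)] neq \<omega>(3) by auto
    moreover have "\<psi> r = conv \<omega> \<chi>' r" if "r \<in> R" for r
      using conv_cong_left_coideal[OF R that lin(1,2) \<omega>(2) eq] \<omega>(3) by simp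
    ultimately show ?thesis
      using character_conv[OF \<omega>(1) \<chi>'] by blast
  qed
qed

end

section \<open>Left coefficients in a skew polynomial algebra\<close>

locale skew_poly =
  fixes sm :: "'k::field \<Rightarrow> 'b::ring_1 \<Rightarrow> 'b"
    and R :: "'b set" and \<sigma> \<delta> :: "'b \<Rightarrow> 'b" and x :: 'b
  assumes alg: "F_algebra sm"
    and aut: "F_alg_automorphism sm R \<sigma>"
    and der: "sigma_derivation sm R \<sigma> \<delta>"
    and skew: "is_skew_poly_alg sm R \<sigma> \<delta> x"
begin

lemma vec: "vector_space sm"
  and sm_mult: "sm c (a * b) = sm c a * b"
  using alg by (auto simp: F_algebra_def)

lemma R_closed:
  "1 \<in> R" "0 \<in> R"
  "a \<in> R \<Longrightarrow> b \<in> R \<Longrightarrow> a + b \<in> R"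
  "a \<in> R \<Longrightarrow> b \<in> R \<Longrightarrow> a * b \<in> R"
  "a \<in> R \<Longrightarrow> b \<in> R \<Longrightarrow> a - b \<in> R"
  "a \<in> R \<Longrightarrow> sm c a \<in> R"
  "a \<in> R \<Longrightarrow> \<sigma> a \<in> R"
  "a \<in> R \<Longrightarrow> \<delta> a \<in> R"
proof -
  interpret vector_space sm by (rule vec)
  have sub: "subalgebra sm R"
    using skew by (simp add: is_skew_poly_alg_def)
  then show closed: "1 \<in> R" "a \<in> R \<Longrightarrow> b \<in> R \<Longrightarrow> a + b \<in> R" "a \<in> R \<Longrightarrow> b \<in> R \<Longrightarrow> a * b \<in> R"
      "a \<in> R \<Longrightarrow> sm c a \<in> R" for a b c
    by (auto simp: subalgebra_def)
  \<comment> \<open>\<open>subalgebra\<close> does not list 0 or differences; they come from scaling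
    by 0 and by -1.\<close>
  show "0 \<in> R"
    using closed(4)[OF closed(1), of 0] by simp
  show "a - b \<in> R" if "a \<in> R" "b \<in> R"
    using closed(2)[OF that(1) closed(4)[OF that(2), of "- 1"]] by simp
  show "a \<in> R \<Longrightarrow> \<sigma> a \<in> R"
    using aut by (auto simp: F_alg_automorphism_def bij_betw_def)
  show "a \<in> R \<Longrightarrow> \<delta> a \<in> R"
    using der by (auto simp: sigma_derivation_def)
qed

lemma x_mult: "r \<in> R \<Longrightarrow> x * r = \<sigma> r * x + \<delta> r"
  using skew by (auto simp: is_skew_poly_alg_def algebra_simps)

definition coeffs :: "'b \<Rightarrow> nat \<Rightarrow> 'b" where
  "coeffs t = (THE c. (\<forall>i. c i \<in> R) \<and> finite {i. c i \<noteq> 0} \<and>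
     t = (\<Sum>i\<in>{i. c i \<noteq> 0}. c i * x ^ i))"

lemma coeffs:
  shows "coeffs t i \<in> R" and "finite {i. coeffs t i \<noteq> 0}"
    and "(\<Sum>i | coeffs t i \<noteq> 0. coeffs t i * x ^ i) = t"
proof -
  have "\<exists>!c. (\<forall>i. c i \<in> R) \<and> finite {i. c i \<noteq> 0} \<and> t = (\<Sum>i\<in>{i. c i \<noteq> 0}. c i * x ^ i)"
    using skew by (simp add: is_skew_poly_alg_def)
  from theI'[OF this, folded coeffs_def]
  show "coeffs t i \<in> R" and "finite {i. coeffs t i \<noteq> 0}"
    and "(\<Sum>i | coeffs t i \<noteq> 0. coeffs t i * x ^ i) = t"
    by auto
qed

text \<open>Uniqueness of the expansion identifies the coefficients. The index set \<open>A\<close>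
  may exceed the support, since coefficients can cancel when elements are added.\<close>

lemma coeffs_sum:
  assumes "finite A" and "\<And>i. c i \<in> R" and "\<And>i. i \<notin> A \<Longrightarrow> c i = 0"
  shows "coeffs (\<Sum>i\<in>A. c i * x ^ i) = c"
proof -
  let ?t = "\<Sum>i\<in>A. c i * x ^ i"
  have sub: "{i. c i \<noteq> 0} \<subseteq> A"
    using assms(3) by auto
  then have fin: "finite {i. c i \<noteq> 0}"
    using assms(1) by (rule finite_subset)
  have "?t = (\<Sum>i\<in>{i. c i \<noteq> 0}. c i * x ^ i)"
    using assms(1) sub by (intro sum.mono_neutral_right) auto
  moreover have "\<exists>!c. (\<forall>i. c i \<in> R) \<and> finite {i. c i \<noteq> 0} \<and> ?t = (\<Sum>i\<in>{i. c i \<noteq> 0}. c i * x ^ i)"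
    using skew by (simp add: is_skew_poly_alg_def)
  ultimately show ?thesis
    unfolding coeffs_def using assms(2) fin by (intro the1_equality) auto
qed

lemma coeffs_superset:
  assumes "finite A" and "{i. coeffs t i \<noteq> 0} \<subseteq> A"
  shows "(\<Sum>i\<in>A. coeffs t i * x ^ i) = t"
proof -
  have "(\<Sum>i | coeffs t i \<noteq> 0. coeffs t i * x ^ i) = (\<Sum>i\<in>A. coeffs t i * x ^ i)"
    using assms by (intro sum.mono_neutral_left) auto
  then show ?thesis
    using coeffs(3)[of t] by simp
qed

lemma coeffs_add: "coeffs (t + u) = (\<lambda>i. coeffs t i + coeffs u i)"
proof -
  let ?A = "{i. coeffs t i \<noteq> 0} \<union> {i. coeffs u i \<noteq> 0}"
  have "t + u = (\<Sum>i\<in>?A. (coeffs t i + coeffs u i) * x ^ i)"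
    using coeffs_superset[of ?A t] coeffs_superset[of ?A u] coeffs(2)
    by (simp add: distrib_right sum.distrib)
  moreover have "coeffs (\<Sum>i\<in>?A. (coeffs t i + coeffs u i) * x ^ i) = (\<lambda>i. coeffs t i + coeffs u i)"
    by (rule coeffs_sum) (auto simp: coeffs R_closed)
  ultimately show ?thesis by simp
qed

lemma coeffs_scale: "coeffs (sm k t) = (\<lambda>i. sm k (coeffs t i))"
proof -
  interpret vector_space sm by (rule vec)
  let ?A = "{i. coeffs t i \<noteq> 0}"
  have "sm k t = sm k (\<Sum>i\<in>?A. coeffs t i * x ^ i)"
    using coeffs(3)[of t] by simp
  also have "\<dots> = (\<Sum>i\<in>?A. sm k (coeffs t i) * x ^ i)"
    by (simp add: scale_sum_right sm_mult)
  moreover have "coeffs (\<Sum>i\<in>?A. sm k (coeffs t i) * x ^ i) = (\<lambda>i. sm k (coeffs t i))"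
    by (rule coeffs_sum) (auto simp: coeffs R_closed)
  ultimately show ?thesis by simp
qed

lemma coeffs_monom:
  assumes "r \<in> R"
  shows "coeffs (r * x ^ n) = (\<lambda>i. if i = n then r else 0)"
  using coeffs_sum[of "{n}" "\<lambda>i. if i = n then r else 0"] assms by (simp add: R_closed)

section \<open>Characters of the skew polynomial algebra: values on R and at
  \<open>x\<close>\<close>

lemma character_eqI:
  assumes "is_character sm \<chi>" "is_character sm \<psi>"
    and "\<And>r. r \<in> R \<Longrightarrow> \<chi> r = \<psi> r" and "\<chi> x = \<psi> x"
  shows "\<chi> = \<psi>"
proof
  fix t
  have hom: "f (r * x ^ i) = f r * f x ^ i" if "is_character sm f" for f r and i :: nat
  proof -
    have "f (x ^ i) = f x ^ i"
      using that by (induction i) (auto simp: is_character_def)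
    then show ?thesis
      using that by (simp add: is_character_def)
  qed
  have sum: "f (\<Sum>i\<in>A. g i) = (\<Sum>i\<in>A. f (g i))" if "is_character sm f"
    for f and g :: "nat \<Rightarrow> 'b" and A
    using that sum_comp_morphism[of f g A] lin_fun_zero[OF vec, of f]
    by (simp add: is_character_def lin_fun_iff[OF vec])
  have "\<chi> (\<Sum>i | coeffs t i \<noteq> 0. coeffs t i * x ^ i) = \<psi> (\<Sum>i | coeffs t i \<noteq> 0. coeffs t i * x ^ i)"
    using assms coeffs(1) by (simp add: sum hom)
  then show "\<chi> t = \<psi> t"
    using coeffs(3)[of t] by simp
qed

lemma character_skew:
  assumes "is_character sm \<chi>" "r \<in> R"
  shows "\<chi> (\<delta> r) = \<chi> x * (\<chi> r - \<chi> (\<sigma> r))"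
proof -
  have "\<chi> (x * r) = \<chi> (\<sigma> r * x + \<delta> r)"
    using assms x_mult by simp
  then show ?thesis
    using assms(1) by (simp add: is_character_def lin_fun_iff[OF vec] algebra_simps)
qed

text \<open>Apply \<chi> to the left coefficients and substitute \<open>a\<close> for
  \<open>x\<close>. This respects the relation \<open>x * r = \<sigma> r * x + \<delta> r\<close>,
  because on R the hypothesis gives that \<chi> is unchanged by \<sigma> and vanishes on the values
  of \<delta>.\<close>

lemma character_extension:
  assumes \<chi>: "is_character sm \<chi>" and inv: "\<And>r. r \<in> R \<Longrightarrow> \<chi> (\<sigma> r) = \<chi> r"
  shows "\<exists>\<psi>. is_character sm \<psi> \<and> (\<forall>r\<in>R. \<psi> r = \<chi> r) \<and> \<psi> x = a"
proof -
  define \<psi> where "\<psi> t = (\<Sum>i | coeffs t i \<noteq> 0. \<chi> (coeffs t i) * a ^ i)" for t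
  have \<chi>_hom: "\<chi> (t + u) = \<chi> t + \<chi> u" "\<chi> (sm k t) = k * \<chi> t" "\<chi> (t * u) = \<chi> t * \<chi> u"
    "\<chi> 0 = 0" "\<chi> 1 = 1" for t u k
    using \<chi> lin_fun_zero[OF vec, of \<chi>] by (auto simp: is_character_def lin_fun_iff[OF vec])
  have \<chi>_\<delta>: "\<chi> (\<delta> r) = 0" if "r \<in> R" for r
    using character_skew[OF \<chi> that] inv[OF that] by simp
  \<comment> \<open>The support in the definition of \<psi> varies with the argument; additivity
    needs a common index set.\<close>
  have \<psi>_superset: "\<psi> t = (\<Sum>i\<in>A. \<chi> (coeffs t i) * a ^ i)"
    if "finite A" "{i. coeffs t i \<noteq> 0} \<subseteq> A" for t A
    unfolding \<psi>_def using that by (intro sum.mono_neutral_left) (auto simp: \<chi>_hom)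
  have \<psi>_add: "\<psi> (t + u) = \<psi> t + \<psi> u" for t u
  proof -
    let ?A = "{i. coeffs t i \<noteq> 0} \<union> {i. coeffs u i \<noteq> 0}"
    have fin: "finite ?A"
      by (simp add: coeffs)
    have "{i. coeffs (t + u) i \<noteq> 0} \<subseteq> ?A"
      by (auto simp: coeffs_add)
    then show ?thesis
      using \<psi>_superset[OF fin, of t] \<psi>_superset[OF fin, of u] \<psi>_superset[OF fin, of "t + u"]
      by (simp add: coeffs_add \<chi>_hom distrib_right sum.distrib)
  qed
  have \<psi>_scale: "\<psi> (sm k t) = k * \<psi> t" for k t
  proof -
    interpret vector_space sm by (rule vec)
    have "{i. coeffs (sm k t) i \<noteq> 0} \<subseteq> {i. coeffs t i \<noteq> 0}"
      by (auto simp: coeffs_scale)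
    from \<psi>_superset[OF coeffs(2) this] show ?thesis
      by (simp add: coeffs_scale \<chi>_hom \<psi>_def sum_distrib_left mult.assoc)
  qed
  have \<psi>_monom: "\<psi> (r * x ^ n) = \<chi> r * a ^ n" if "r \<in> R" for r n
  proof -
    have "{i. coeffs (r * x ^ n) i \<noteq> 0} \<subseteq> {n}"
      by (simp add: coeffs_monom[OF that] subset_iff)
    from \<psi>_superset[OF _ this] show ?thesis
      by (simp add: coeffs_monom[OF that])
  qed
  have \<psi>_R: "\<psi> r = \<chi> r" if "r \<in> R" for r
    using \<psi>_monom[OF that, of 0] by simp
  have \<psi>_x: "\<psi> x = a"
    using \<psi>_monom[of 1 1] by (simp add: R_closed \<chi>_hom)
  have \<psi>_sum: "\<psi> (\<Sum>i\<in>A. g i) = (\<Sum>i\<in>A. \<psi> (g i))" for g :: "nat \<Rightarrow> 'b" and A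
    using sum_comp_morphism[of \<psi> g A] \<psi>_add \<psi>_R[of 0] by (simp add: R_closed \<chi>_hom)
  \<comment> \<open>Multiplicativity is built up in the left factor: elements of R, then
    \<open>x\<close>, then powers of \<open>x\<close>, then sums. Only \<open>x\<close> has to be
    moved past coefficients.\<close>
  have \<psi>_mult_R: "\<psi> (r * t) = \<chi> r * \<psi> t" if "r \<in> R" for r t
  proof -
    have "\<psi> (r * (\<Sum>i | coeffs t i \<noteq> 0. coeffs t i * x ^ i)) =
        (\<Sum>i | coeffs t i \<noteq> 0. \<psi> ((r * coeffs t i) * x ^ i))"
      by (simp add: sum_distrib_left \<psi>_sum mult.assoc)
    also have "\<dots> = \<chi> r * \<psi> t"
      using that
      by (simp add: \<psi>_monom R_closed coeffs \<chi>_hom) (simp add: \<psi>_def[of t] sum_distrib_left mult.assoc)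
    finally show ?thesis
      using coeffs(3)[of t] by simp
  qed
  have \<psi>_mult_x: "\<psi> (x * t) = a * \<psi> t" for t
  proof -
    have step: "\<psi> (x * (r * x ^ i)) = a * (\<chi> r * a ^ i)" if "r \<in> R" for r i
    proof -
      have "x * (r * x ^ i) = \<sigma> r * x ^ Suc i + \<delta> r * x ^ i"
        using x_mult[OF that] by (simp add: algebra_simps flip: mult.assoc)
      then show ?thesis
        using that by (simp only: \<psi>_add \<psi>_monom R_closed inv \<chi>_\<delta>) simp
    qed
    have "\<psi> (x * (\<Sum>i | coeffs t i \<noteq> 0. coeffs t i * x ^ i)) = a * \<psi> t"
      by (simp add: sum_distrib_left \<psi>_sum step coeffs(1) \<psi>_def[of t])
    then show ?thesis
      using coeffs(3)[of t] by simp
  qed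
  have \<psi>_mult_pow: "\<psi> (x ^ n * t) = a ^ n * \<psi> t" for n t
    by (induction n) (auto simp: \<psi>_mult_x mult.assoc)
  have \<psi>_mult: "\<psi> (s * t) = \<psi> s * \<psi> t" for s t
  proof -
    have "\<psi> ((\<Sum>i | coeffs s i \<noteq> 0. coeffs s i * x ^ i) * t) = \<psi> s * \<psi> t"
      by (simp add: sum_distrib_right \<psi>_sum mult.assoc \<psi>_mult_R \<psi>_mult_pow coeffs(1) \<psi>_def[of s])
    then show ?thesis
      using coeffs(3)[of s] by simp
  qed
  have "is_character sm \<psi>"
    using \<psi>_add \<psi>_scale \<psi>_mult \<psi>_R[of 1]
    by (simp add: is_character_def lin_fun_iff[OF vec] R_closed \<chi>_hom)
  with \<psi>_R \<psi>_x show ?thesis by blast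
qed

text \<open>If \<sigma> preserves \<chi> on R, the value at \<open>x\<close> is free. Conversely,
  two extensions differ at \<open>x\<close> but agree at \<open>\<delta> r\<close>, so comparing
  \<open>character_skew\<close> for both forces the factor
  \<open>\<chi> r - \<chi> (\<sigma> r)\<close> to vanish.\<close>

lemma invariant_iff_nonunique_extension:
  assumes \<chi>: "is_character sm \<chi>"
  shows "(\<forall>r\<in>R. \<chi> (\<sigma> r) = \<chi> r) \<longleftrightarrow>
    (\<exists>\<psi>. is_character sm \<psi> \<and> \<psi> \<noteq> \<chi> \<and> (\<forall>r\<in>R. \<chi> r = \<psi> r))" (is "?L \<longleftrightarrow> ?R")
proof
  assume ?L
  \<comment> \<open>Adding 1 guarantees a value at \<open>x\<close> other than that of
    \<chi>.\<close>
  then obtain \<psi> where "is_character sm \<psi>" "\<forall>r\<in>R. \<psi> r = \<chi> r" "\<psi> x = \<chi> x + 1"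
    using character_extension[OF \<chi>] by blast
  then show ?R
    by (metis add_cancel_left_right zero_neq_one)
next
  assume ?R
  then obtain \<psi> where \<psi>: "is_character sm \<psi>" "\<psi> \<noteq> \<chi>" "\<And>r. r \<in> R \<Longrightarrow> \<chi> r = \<psi> r"
    by blast
  then have neq: "\<chi> x \<noteq> \<psi> x"
    using character_eqI[OF \<chi> \<psi>(1)] by auto
  show ?L
  proof
    fix r assume r: "r \<in> R"
    have "\<chi> x * (\<chi> r - \<chi> (\<sigma> r)) = \<psi> x * (\<chi> r - \<chi> (\<sigma> r))"
      using character_skew[OF \<chi> r] character_skew[OF \<psi>(1) r]
        \<psi>(3)[OF r] \<psi>(3)[OF R_closed(7)[OF r]] \<psi>(3)[OF R_closed(8)[OF r]] by metis
    with neq show "\<chi> (\<sigma> r) = \<chi> r" by simp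
  qed
qed

section \<open>From invariance of characters to the types of their kernels\<close>

lemma sigma_image_kernel_iff:
  assumes \<chi>: "is_character sm \<chi>"
  shows "\<sigma> ` ({t. \<chi> t = 0} \<inter> R) = {t. \<chi> t = 0} \<inter> R \<longleftrightarrow> (\<forall>r\<in>R. \<chi> (\<sigma> r) = \<chi> r)"
    (is "\<sigma> ` ?m = ?m \<longleftrightarrow> ?R")
proof
  assume eq: "\<sigma> ` ?m = ?m"
  show ?R
  proof
    fix r assume r: "r \<in> R"
    \<comment> \<open>The scalar part of \<open>r\<close>: \<sigma> fixes it, and
      \<open>r - ?s\<close> lies in the kernel. Hence the kernel determines \<chi> on R.\<close>
    let ?s = "sm (\<chi> r) 1"
    have s: "?s \<in> R" "\<sigma> ?s = ?s" "\<chi> ?s = \<chi> r"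
      using \<chi> aut R_closed
      by (auto simp: is_character_def lin_fun_iff[OF vec] F_alg_automorphism_def)
    have lin: "lin_fun sm \<chi>"
      using \<chi> by (simp add: is_character_def)
    note \<chi>_diff = lin_fun_diff[OF vec lin]
    have "\<sigma> ((r - ?s) + ?s) = \<sigma> (r - ?s) + \<sigma> ?s"
      using aut R_closed(5)[OF r s(1)] s(1) unfolding F_alg_automorphism_def by blast
    then have "\<sigma> (r - ?s) = \<sigma> r - ?s"
      using s(2) by (simp add: algebra_simps)
    moreover have "r - ?s \<in> ?m"
      using r s by (simp add: \<chi>_diff R_closed)
    ultimately have "\<sigma> r - ?s \<in> ?m"
      using eq by (metis imageI)
    then show "\<chi> (\<sigma> r) = \<chi> r"
      using s by (simp add: \<chi>_diff)
  qed
next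
  assume R: ?R
  have "\<sigma> ` R = R"
    using aut by (simp add: F_alg_automorphism_def bij_betw_def)
  have "?m \<subseteq> \<sigma> ` ?m"
  proof
    fix s assume s: "s \<in> ?m"
    then obtain r where "r \<in> R" "s = \<sigma> r"
      using \<open>\<sigma> ` R = R\<close> by blast
    with s R show "s \<in> \<sigma> ` ?m" by auto
  qed
  moreover have "\<sigma> ` ?m \<subseteq> ?m"
    using R by (auto simp: R_closed)
  ultimately show "\<sigma> ` ?m = ?m" by blast
qed

text \<open>Both claims rest on \<open>character_skew\<close>. In the invariant case its right side
  is zero. In the other case, \<chi> and \<open>\<chi> \<circ> \<sigma>\<close> are multiplicative
  on R with commuting values, so both kill commutators, and \<chi> kills their images under
  \<delta>.\<close>

lemma kernel_type:
  assumes \<chi>: "is_character sm \<chi>"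
  shows "(\<forall>r\<in>R. \<chi> (\<sigma> r) = \<chi> r) \<Longrightarrow> invariant_type R \<sigma> \<delta> {t. \<chi> t = 0}"
    and "\<not> (\<forall>r\<in>R. \<chi> (\<sigma> r) = \<chi> r) \<Longrightarrow> variant_type R \<sigma> \<delta> {t. \<chi> t = 0}"
proof -
  assume "\<forall>r\<in>R. \<chi> (\<sigma> r) = \<chi> r"
  then show "invariant_type R \<sigma> \<delta> {t. \<chi> t = 0}"
    using sigma_image_kernel_iff[OF \<chi>]
    by (auto simp: invariant_type_def R_closed character_skew[OF \<chi>])
next
  assume "\<not> (\<forall>r\<in>R. \<chi> (\<sigma> r) = \<chi> r)"
  moreover have "\<chi> (\<delta> (a * b - b * a)) = 0" if "a \<in> R" "b \<in> R" for a b
  proof -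
    have lin: "lin_fun sm \<chi>" and mult: "\<And>a b. \<chi> (a * b) = \<chi> a * \<chi> b"
      using \<chi> by (auto simp: is_character_def)
    have add: "\<delta> (p + q) = \<delta> p + \<delta> q" if "p \<in> R" "q \<in> R" for p q
      using der that by (simp add: sigma_derivation_def)
    have "\<delta> ((a * b - b * a) + b * a) = \<delta> (a * b - b * a) + \<delta> (b * a)"
      using that by (intro add) (auto simp: R_closed)
    then have "\<chi> (\<delta> (a * b - b * a)) = \<chi> (\<delta> (a * b)) - \<chi> (\<delta> (b * a))"
      using lin by (simp add: lin_fun_iff[OF vec])
    also have "\<dots> = 0"
      using that aut
      by (simp add: character_skew[OF \<chi>] R_closed F_alg_automorphism_def mult)
    finally show ?thesis .
  qed
  ultimately show "variant_type R \<sigma> \<delta> {t. \<chi> t = 0}"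
    using sigma_image_kernel_iff[OF \<chi>] by (auto simp: variant_type_def R_closed)
qed

end

theorem theorem4p5:
  fixes sm :: "'k::alg_closed_field \<Rightarrow> 'b::ring_1 \<Rightarrow> 'b"
    and R :: "'b set" and \<sigma> \<delta> :: "'b \<Rightarrow> 'b" and x :: 'b
    and \<Delta> :: "'b \<Rightarrow> ('b \<times> 'b) list" and \<epsilon> :: "'b \<Rightarrow> 'k" and S :: "'b \<Rightarrow> 'b"
  assumes "F_algebra sm"
    and "subalgebra sm R"
    and "F_alg_automorphism sm R \<sigma>"
    and "sigma_derivation sm R \<sigma> \<delta>"
    and "is_skew_poly_alg sm R \<sigma> \<delta> x"
    and "hopf_algebra sm \<Delta> \<epsilon> S"
    and "right_coideal sm \<Delta> R \<or> left_coideal sm \<Delta> R"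
  shows "(\<forall>M\<in>Xi sm. invariant_type R \<sigma> \<delta> M) \<or> (\<forall>M\<in>Xi sm. variant_type R \<sigma> \<delta> M)"
proof -
  interpret hopf sm \<Delta> \<epsilon> S by unfold_locales fact
  interpret P: skew_poly sm R \<sigma> \<delta> x by unfold_locales fact+
  have Xi: "\<exists>\<chi>. is_character sm \<chi> \<and> M = {t. \<chi> t = 0}" if "M \<in> Xi sm" for M
    using that by (auto simp: Xi_def is_character_def)
  show ?thesis
  proof (cases "\<exists>\<chi>. is_character sm \<chi> \<and> (\<forall>r\<in>R. \<chi> (\<sigma> r) = \<chi> r)")
    case True
    then obtain \<chi> where \<chi>: "is_character sm \<chi>" "\<forall>r\<in>R. \<chi> (\<sigma> r) = \<chi> r"
      by blast
    \<comment> \<open>A single invariant character has a rival extension \<chi>'; translating this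
      pair gives every character a rival, hence makes every character invariant.\<close>
    then obtain \<chi>' where \<chi>': "is_character sm \<chi>'" "\<chi> \<noteq> \<chi>'" "\<And>r. r \<in> R \<Longrightarrow> \<chi> r = \<chi>' r"
      using P.invariant_iff_nonunique_extension by metis
    have "\<forall>r\<in>R. \<psi> (\<sigma> r) = \<psi> r" if "is_character sm \<psi>" for \<psi>
      using nonunique_extension_transfer[OF assms(7) \<chi>(1) \<chi>' that]
        P.invariant_iff_nonunique_extension[OF that] by blast
    then have "\<forall>M\<in>Xi sm. invariant_type R \<sigma> \<delta> M"
      using Xi P.kernel_type(1) by blast
    then show ?thesis ..
  next
    case False
    then have "\<forall>M\<in>Xi sm. variant_type R \<sigma> \<delta> M"
      using Xi P.kernel_type(2) by blast
    then show ?thesis ..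
  qed
qed

end
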